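(* Let $M$ be a subspace of a vector space $L$ over $\mathbb{C}$ and let $p : L \to [0,+\infty)$ be a semi-norm. If $g : M \to \mathbb{C}$ is a ($\mathbb{C}$-)linear functional such that $|g(x)| \leq p(x)$ for all $x \in M$, then there exists a ($\mathbb{C}$-)linear functional $f : L \to \mathbb{C}$ such that (1) $f$ extends $g$ to $L$, i.e., $f\vert_{M} = g$; and (2) $|f(x)| \leq p(x)$ for all $x \in L$.
   Context: A function $p : L \to [0,+\infty)$ on a vector space $L$ over $\mathbb{C}$ is a semi-norm if for all $x, y \in L$ and $\lambda \in \mathbb{C}$ one has $p(x+y) \leq p(x) + p(y)$ and $p(\lambda x) = |\lambda| p(x)$. *)

theory Defs
  imports "HOL-Analysis.Analysis"
begin

(* The complex vector space L is the whole type 'a with scalar multiplication scl,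
   subject to the locale predicate "vector_space scl".  The unqualified constants
   subspace and linear of the library refer to real scalars. *)

definition seminorm :: "(complex \<Rightarrow> 'a::ab_group_add \<Rightarrow> 'a) \<Rightarrow> ('a \<Rightarrow> real) \<Rightarrow> bool" where
  "seminorm scl p \<longleftrightarrow>
     (\<forall>x. 0 \<le> p x) \<and>
     (\<forall>x y. p (x + y) \<le> p x + p y) \<and>
     (\<forall>c x. p (scl c x) = cmod c * p x)"

(* A functional on a subspace M is a total function of which only the values on M matter. *)

definition linear_functional_on ::
    "(complex \<Rightarrow> 'a::ab_group_add \<Rightarrow> 'a) \<Rightarrow> 'a set \<Rightarrow> ('a \<Rightarrow> complex) \<Rightarrow> bool" where
  "linear_functional_on scl M g \<longleftrightarrow>
     (\<forall>x\<in>M. \<forall>y\<in>M. g (x + y) = g x + g y) \<and>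
     (\<forall>c. \<forall>x\<in>M. g (scl c x) = c * g x)"

end

theory Submission
  imports Defs
begin

text \<open>
  Real-linear functionals dominated by \<open>p\<close> are handled through their graphs, ordered by
  inclusion: Zorn's lemma gives a maximal dominated graph, and the usual choice of a real number
  between a supremum and an infimum shows that its domain is the whole space. In the complex
  case the real part of \<open>g\<close> is extended to a real-linear \<open>u \<le> p\<close>, and \<open>f x = u x - \<i> u (\<i> x)\<close>
  is the unique complex-linear functional with real part \<open>u\<close>. Rotating \<open>x\<close> so that \<open>f x\<close>
  becomes real and nonnegative turns \<open>u \<le> p\<close> into \<open>\<bar>f\<bar> \<le> p\<close>.
\<close>

text \<open>A linear subspace of the product lying below \<open>p\<close>. Single-valuedness is left
  out of the definition because domination implies it, so it need not be checked for unions or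
  extensions.\<close>

definition dominated_graph ::
    "(real \<Rightarrow> 'a::ab_group_add \<Rightarrow> 'a) \<Rightarrow> ('a \<Rightarrow> real) \<Rightarrow> ('a \<times> real) set \<Rightarrow> bool" where
  "dominated_graph scl p G \<longleftrightarrow>
     (0, 0) \<in> G \<and>
     (\<forall>x r y s. (x, r) \<in> G \<longrightarrow> (y, s) \<in> G \<longrightarrow> (x + y, r + s) \<in> G) \<and>
     (\<forall>c x r. (x, r) \<in> G \<longrightarrow> (scl c x, c * r) \<in> G) \<and>
     (\<forall>x r. (x, r) \<in> G \<longrightarrow> r \<le> p x)"

lemma dominated_graphD:
  assumes "dominated_graph scl p G"
  shows "(0, 0) \<in> G"
    and "(x, r) \<in> G \<Longrightarrow> (y, s) \<in> G \<Longrightarrow> (x + y, r + s) \<in> G"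
    and "(x, r) \<in> G \<Longrightarrow> (scl c x, c * r) \<in> G"
    and "(x, r) \<in> G \<Longrightarrow> r \<le> p x"
  using assms unfolding dominated_graph_def by blast+

text \<open>Each condition involves at most two pairs, and two pairs of the union already lie in a
  common member of the chain.\<close>

lemma dominated_graph_Union_chain:
  assumes "C \<noteq> {}" "\<And>G. G \<in> C \<Longrightarrow> dominated_graph scl p G"
    and "\<And>G H. G \<in> C \<Longrightarrow> H \<in> C \<Longrightarrow> G \<subseteq> H \<or> H \<subseteq> G"
  shows "dominated_graph scl p (\<Union>C)"
  unfolding dominated_graph_def
proof (intro conjI allI impI)
  show "(0, 0) \<in> \<Union>C"
    using assms(1,2) dominated_graphD(1) by fastforce
next
  fix x r y s assume "(x, r) \<in> \<Union>C" "(y, s) \<in> \<Union>C"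
  then obtain G H where "G \<in> C" "H \<in> C" "(x, r) \<in> G" "(y, s) \<in> H" by blast
  then obtain K where "K \<in> C" "(x, r) \<in> K" "(y, s) \<in> K"
    using assms(3) by blast
  then show "(x + y, r + s) \<in> \<Union>C"
    using dominated_graphD(2)[OF assms(2)] by blast
next
  fix c x r assume "(x, r) \<in> \<Union>C"
  then show "(scl c x, c * r) \<in> \<Union>C"
    using dominated_graphD(3)[OF assms(2)] by blast
next
  fix x r assume "(x, r) \<in> \<Union>C"
  then show "r \<le> p x"
    using dominated_graphD(4)[OF assms(2)] by blast
qed

context
  fixes scl :: "real \<Rightarrow> 'a::ab_group_add \<Rightarrow> 'a" and p :: "'a \<Rightarrow> real"
  assumes vs: "vector_space scl"
    and p_add: "\<And>x y. p (x + y) \<le> p x + p y"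
    and p_scale: "\<And>c x. 0 \<le> c \<Longrightarrow> p (scl c x) = c * p x"
begin

interpretation V: vector_space scl by (rule vs)

text \<open>Two values over \<open>x\<close> give a pair over 0 whose second entry is their
  difference; since \<open>p 0 = 0\<close>, neither value exceeds the other.\<close>

lemma dominated_graph_unique:
  assumes G: "dominated_graph scl p G" and "(x, r) \<in> G" "(x, s) \<in> G"
  shows "r = s"
proof -
  have p0: "p 0 = 0" using p_scale[of 0 0] by simp
  have "a \<le> b" if "(x, a) \<in> G" "(x, b) \<in> G" for a b
  proof -
    have "(x + scl (-1) x, a + (-1) * b) \<in> G"
      using that dominated_graphD[OF G] by blast
    then have "a - b \<le> p 0" using dominated_graphD(4)[OF G] by fastforce
    then show ?thesis using p0 by simp
  qed
  then show ?thesis using assms by (simp add: order_antisym)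
qed

text \<open>One-dimensional extension by the direction \<open>z\<close>. No case split on
  \<open>z\<close> is required: if \<open>z\<close> is already in the domain of \<open>G\<close>,
  uniqueness for \<open>H\<close> forces \<open>a\<close> to be the old value.\<close>

lemma dominated_graph_extend:
  assumes G: "dominated_graph scl p G"
  shows "\<exists>H a. dominated_graph scl p H \<and> G \<subseteq> H \<and> (z, a) \<in> H"
proof -
  note GD = dominated_graphD[OF G]
  \<comment> \<open>Domination at \<open>x - z\<close> and \<open>y + z\<close> demands
    \<open>r - p (x - z) \<le> a \<le> p (y + z) - s\<close>; the supremum of the left sides is the
    least candidate.\<close>
  define S where "S = {r - p (x - z) | x r. (x, r) \<in> G}"
  define a where "a = Sup S"
  have sep: "r - p (x - z) \<le> p (y + z) - s" if "(x, r) \<in> G" "(y, s) \<in> G" for x r y s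
  proof -
    have "r + s \<le> p ((x - z) + (y + z))" using GD(4)[OF GD(2)[OF that]] by simp
    also have "\<dots> \<le> p (x - z) + p (y + z)" by (rule p_add)
    finally show ?thesis by simp
  qed
  have "S \<noteq> {}" using GD(1) by (auto simp: S_def)
  have "bdd_above S"
    using sep[OF _ GD(1)] by (intro bdd_aboveI[of _ "p (0 + z) - 0"]) (auto simp: S_def)
  then have lower: "r - a \<le> p (x - z)" if "(x, r) \<in> G" for x r
    using cSup_upper[of "r - p (x - z)" S] that by (force simp: a_def S_def)
  have upper: "s + a \<le> p (y + z)" if "(y, s) \<in> G" for y s
    using cSup_least[OF \<open>S \<noteq> {}\<close>, of "p (y + z) - s"] sep[OF _ that]
    by (force simp: a_def S_def)
  define H where "H = {(x + scl t z, r + t * a) | x r t. (x, r) \<in> G}"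
  have HI: "(x', r') \<in> H" if "(x, r) \<in> G" "x' = x + scl t z" "r' = r + t * a" for x r t x' r'
    using that by (auto simp: H_def)
  have "dominated_graph scl p H"
    unfolding dominated_graph_def
  proof (intro conjI allI impI)
    show "(0, 0) \<in> H" by (rule HI[of _ _ _ 0, OF GD(1)]) auto
  next
    fix x' r' y' s' assume "(x', r') \<in> H" "(y', s') \<in> H"
    then obtain x r t y s t' where *: "(x, r) \<in> G" "(y, s) \<in> G"
      "x' = x + scl t z" "r' = r + t * a" "y' = y + scl t' z" "s' = s + t' * a"
      unfolding H_def by blast
    show "(x' + y', r' + s') \<in> H"
      by (rule HI[OF GD(2)[OF *(1,2)], of _ "t + t'"])
        (simp_all add: * V.scale_left_distrib algebra_simps)
  next
    fix c x' r' assume "(x', r') \<in> H"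
    then obtain x r t where *: "(x, r) \<in> G" "x' = x + scl t z" "r' = r + t * a"
      by (auto simp: H_def)
    show "(scl c x', c * r') \<in> H"
      by (rule HI[OF GD(3)[OF *(1)], of _ c "c * t"])
        (simp_all add: * V.scale_right_distrib algebra_simps)
  next
    fix x' r' assume "(x', r') \<in> H"
    then obtain x r t where *: "(x, r) \<in> G" "x' = x + scl t z" "r' = r + t * a"
      by (auto simp: H_def)
    \<comment> \<open>Positive homogeneity lets \<open>\<bar>t\<bar>\<close> be factored out, so
      \<open>t > 0\<close> reduces to \<open>upper\<close> and \<open>t < 0\<close> to
      \<open>lower\<close>.\<close>
    consider "t = 0" | "t > 0" | "t < 0" by linarith
    then show "r' \<le> p x'"
    proof cases
      case 1
      then show ?thesis using GD(4) * by simp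
    next
      case 2
      have "r' = t * (inverse t * r + a)" using 2 * by (simp add: field_simps)
      also have "\<dots> \<le> t * p (scl (inverse t) x + z)"
        using 2 by (intro mult_left_mono upper GD(3) *) auto
      also have "\<dots> = p (scl t (scl (inverse t) x + z))" using 2 by (simp add: p_scale)
      also have "\<dots> = p x'" using 2 * by (simp add: V.scale_right_distrib)
      finally show ?thesis .
    next
      case 3
      have "r' = (-t) * (inverse (-t) * r - a)" using 3 * by (simp add: field_simps)
      also have "\<dots> \<le> (-t) * p (scl (inverse (-t)) x - z)"
        using 3 by (intro mult_left_mono lower GD(3) *) auto
      also have "\<dots> = p (scl (-t) (scl (inverse (-t)) x - z))"
        using 3 by (subst p_scale) auto
      also have "\<dots> = p x'" using 3 * by (simp add: V.scale_right_diff_distrib)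
      finally show ?thesis .
    qed
  qed
  moreover have "G \<subseteq> H" by (auto intro: HI[of _ _ _ 0])
  moreover have "(z, a) \<in> H" by (rule HI[of _ _ _ 1, OF GD(1)]) auto
  ultimately show ?thesis by blast
qed

text \<open>Only a one-sided bound by a sublinear \<open>p\<close> is involved, which is the form
  that suits the real part of a complex functional.\<close>

theorem hahn_banach_real:
  assumes M: "V.subspace M"
    and h_add: "\<And>x y. x \<in> M \<Longrightarrow> y \<in> M \<Longrightarrow> h (x + y) = h x + h y"
    and h_scale: "\<And>c x. x \<in> M \<Longrightarrow> h (scl c x) = c * h x"
    and h_le: "\<And>x. x \<in> M \<Longrightarrow> h x \<le> p x"
  shows "\<exists>f. Vector_Spaces.linear scl (*) f \<and> (\<forall>x\<in>M. f x = h x) \<and> (\<forall>x. f x \<le> p x)"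
proof -
  define G0 where "G0 = (\<lambda>x. (x, h x)) ` M"
  define A where "A = {G. dominated_graph scl p G \<and> G0 \<subseteq> G}"
  have "h 0 = 0" using h_scale[of 0 0] V.subspace_0[OF M] by simp
  then have "dominated_graph scl p G0"
    using V.subspace_0[OF M] V.subspace_add[OF M] V.subspace_scale[OF M]
    by (auto simp: dominated_graph_def G0_def h_add h_scale h_le image_iff)
  then have "A \<noteq> {}" by (auto simp: A_def)
  moreover have "\<Union>C \<in> A" if "C \<noteq> {}" "subset.chain A C" for C
  proof -
    have "C \<subseteq> A" using that(2) by (simp add: subset_chain_def)
    then have "dominated_graph scl p (\<Union>C)"
      using that unfolding subset_chain_def by (intro dominated_graph_Union_chain) (auto simp: A_def)
    then show ?thesis using \<open>C \<subseteq> A\<close> that(1) by (auto simp: A_def)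
  qed
  ultimately obtain G where "G \<in> A" and max: "\<And>H. H \<in> A \<Longrightarrow> G \<subseteq> H \<Longrightarrow> H = G"
    using subset_Zorn_nonempty[of A] by metis
  then have G: "dominated_graph scl p G" and "G0 \<subseteq> G" by (auto simp: A_def)
  note GD = dominated_graphD[OF G]
  have "\<exists>a. (x, a) \<in> G" for x
  proof -
    obtain H a where H: "dominated_graph scl p H" "G \<subseteq> H" "(x, a) \<in> H"
      using dominated_graph_extend[OF G] by blast
    then have "H = G" using max \<open>G0 \<subseteq> G\<close> by (auto simp: A_def)
    then show ?thesis using H by blast
  qed
  then obtain f where f: "\<And>x. (x, f x) \<in> G" by metis
  \<comment> \<open>Single-valuedness turns the closure properties of \<open>G\<close> into
    linearity of \<open>f\<close>.\<close>
  have f_eq: "f x = r" if "(x, r) \<in> G" for x r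
    using dominated_graph_unique[OF G f that] .
  have "Vector_Spaces.linear scl (*) f"
    unfolding Vector_Spaces.linear_def module_hom_def module_hom_axioms_def
    using f_eq[OF GD(2)[OF f f]] f_eq[OF GD(3)[OF f]] vs V.module_axioms
    by (auto intro: vector_space_over_itself.vector_space_axioms
        vector_space_over_itself.module_axioms)
  moreover have "\<forall>x\<in>M. f x = h x"
    using \<open>G0 \<subseteq> G\<close> f_eq by (auto simp: G0_def)
  ultimately show ?thesis using GD(4)[OF f] by blast
qed

end

theorem theorem2p3:
  fixes scl :: "complex \<Rightarrow> 'a::ab_group_add \<Rightarrow> 'a"
    and M :: "'a set"
    and p :: "'a \<Rightarrow> real"
    and g :: "'a \<Rightarrow> complex"
  assumes "vector_space scl"
    and "module.subspace scl M"
    and "seminorm scl p"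
    and "linear_functional_on scl M g"
    and "\<forall>x\<in>M. cmod (g x) \<le> p x"
  shows "\<exists>f :: 'a \<Rightarrow> complex.
           Vector_Spaces.linear scl (*) f \<and>
           (\<forall>x\<in>M. f x = g x) \<and>
           (\<forall>x. cmod (f x) \<le> p x)"
proof -
  interpret C: vector_space scl by fact
  \<comment> \<open>Restriction of scalars: the same group seen as a real vector space.\<close>
  define rscl where "rscl = (\<lambda>t. scl (complex_of_real t))"
  interpret R: vector_space rscl
    by unfold_locales (simp_all add: rscl_def C.scale_right_distrib C.scale_left_distrib)
  have M: "C.subspace M" by fact
  then have "R.subspace M"
    unfolding R.subspace_def C.subspace_def by (simp add: rscl_def)
  have p: "p (x + y) \<le> p x + p y" "p (scl c x) = cmod c * p x" for x y c
    using assms(3) by (auto simp: seminorm_def)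
  have g: "x \<in> M \<Longrightarrow> y \<in> M \<Longrightarrow> g (x + y) = g x + g y" "x \<in> M \<Longrightarrow> g (scl c x) = c * g x"
    for x y c
    using assms(4) by (auto simp: linear_functional_on_def)
  have "\<exists>u. Vector_Spaces.linear rscl (*) u \<and> (\<forall>x\<in>M. u x = Re (g x)) \<and> (\<forall>x. u x \<le> p x)"
  proof (rule hahn_banach_real)
    show "Re (g x) \<le> p x" if "x \<in> M" for x
      using assms(5) that complex_Re_le_cmod order_trans by blast
  qed (use R.vector_space_axioms \<open>R.subspace M\<close> in \<open>simp_all add: p g rscl_def\<close>)
  then obtain u where u: "Vector_Spaces.linear rscl (*) u"
    and u_g: "\<And>x. x \<in> M \<Longrightarrow> u x = Re (g x)" and u_le: "\<And>x. u x \<le> p x"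
    by blast
  interpret u: Vector_Spaces.linear rscl "(*)" u by fact
  define f where "f x = Complex (u x) (- u (scl \<i> x))" for x
  have f_add: "f (x + y) = f x + f y" for x y
    by (simp add: f_def C.scale_right_distrib u.add complex_eq_iff)
  have f_scale: "f (scl c x) = c * f x" for c x
  proof -
    \<comment> \<open>As \<open>u\<close> is only real-linear, a complex factor is split into real
      multiples of \<open>y\<close> and \<open>scl \<i> y\<close>.\<close>
    have split: "u (scl (Complex a b) y) = a * u y + b * u (scl \<i> y)" for a b y
    proof -
      have "scl (Complex a b) y = rscl a y + rscl b (scl \<i> y)"
        by (simp add: rscl_def Complex_eq C.scale_left_distrib mult.commute)
      then show ?thesis by (simp add: u.add u.scale)
    qed
    have "\<i> * c = Complex (- Im c) (Re c)" by (simp add: complex_eq_iff)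
    then have "u (scl \<i> (scl c x)) = - Im c * u x + Re c * u (scl \<i> x)"
      using split by (simp only: C.scale_scale)
    moreover have "u (scl c x) = Re c * u x + Im c * u (scl \<i> x)"
      using split[of "Re c" "Im c" x] by simp
    ultimately show ?thesis by (simp add: f_def complex_eq_iff)
  qed
  have "Vector_Spaces.linear scl (*) f"
    unfolding Vector_Spaces.linear_def module_hom_def module_hom_axioms_def
    using f_add f_scale C.vector_space_axioms C.module_axioms
    by (auto intro: vector_space_over_itself.vector_space_axioms
        vector_space_over_itself.module_axioms)
  \<comment> \<open>Since \<open>M\<close> is closed under multiplication by \<i>, the imaginary
    part is recovered from \<open>Re (g (scl \<i> x)) = - Im (g x)\<close>.\<close>
  moreover have "f x = g x" if "x \<in> M" for x
    using that C.subspace_scale[OF M that] by (simp add: f_def u_g g complex_eq_iff)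
  moreover have "cmod (f x) \<le> p x" for x
  \<comment> \<open>For \<open>f x = 0\<close> the quotient \<open>c\<close> below would be 0 and
    not of modulus 1.\<close>
  proof (cases "f x = 0")
    case True
    then show ?thesis using assms(3) by (simp add: seminorm_def)
  next
    case False
    define c where "c = cmod (f x) / f x"
    have "cmod c = 1" using False by (simp add: c_def norm_divide)
    have "c * f x = cmod (f x)"
      using False by (simp add: c_def)
    then have "cmod (f x) = Re (f (scl c x))" by (simp add: f_scale)
    also have "\<dots> = u (scl c x)" by (simp add: f_def)
    also have "\<dots> \<le> p (scl c x)" by (rule u_le)
    also have "\<dots> = p x" using \<open>cmod c = 1\<close> by (simp add: p)
    finally show ?thesis .
  qed
  ultimately show ?thesis by blast
qed

end
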